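(* Let $n\ge1$ and let $U$ be a commutative Pauli-$Z$ circuit on $n$ qubits determined by distinct non-empty sets $Q_1,\dots,Q_N\subseteq\{1,\dots,n\}$ (see the context), where in general $n\le N\le 2^n-1$. If the circuit has the minimum number of rotations $N=n$, then the frame potential of $U$ is explicitly given for all positive integers $t$ by $$\mathcal{F}_U(t)=\left(\frac{\Gamma(t+\tfrac12)}{\sqrt{\pi}\,\Gamma(t+1)}\right)^n,$$ where $\Gamma$ denotes the Gamma function.
   Context: Pauli-$Z$ circuit: the initial state is $\psi_0=|+\rangle^{\otimes n}$, i.e. the vector in $\mathbb{C}^{2^n}$ with all entries $2^{-n/2}$. For $j=1,\dots,N$, $H_j=\bigotimes_{m=1}^n O^{(j)}_m$ with $O^{(j)}_m=Z=\mathrm{diag}(1,-1)$ if $m\in Q_j$ and $O^{(j)}_m=I_2$ (the $2\times2$ identity) otherwise. The circuit is $U(\boldsymbol{\theta})=e^{i(\theta_1H_1+\dots+\theta_NH_N)}$, $\boldsymbol{\theta}\in[-\pi,\pi]^N$. Frame potential: $$\mathcal{F}_U(t)=\frac{1}{(2\pi)^{2N}}\int_{[-\pi,\pi]^{2N}}|\langle\psi_0|U(\boldsymbol{\theta})^\dagger U(\boldsymbol{\theta}')|\psi_0\rangle|^{2t}\,d\boldsymbol{\theta}\,d\boldsymbol{\theta}'.$$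
   Formalization: It is additionally assumed that the sets Q_1,…,Q_N generate all subsets of {1,…,n} under symmetric difference; without this the formula fails, e.g. n=N=3, Q={1},{2},{1,2}, t=1 gives 1/4 rather than 1/8. *)

theory Defs
  imports "HOL-Analysis.Analysis" "Jordan_Normal_Form.Schur_Decomposition"
begin

text \<open>The Kronecker product; the first factor supplies the most significant part of the index.\<close>

definition kronecker :: "complex mat \<Rightarrow> complex mat \<Rightarrow> complex mat" where
  "kronecker A B =
     mat (dim_row A * dim_row B) (dim_col A * dim_col B)
       (\<lambda>(r, c). A $$ (r div dim_row B, c div dim_col B) * B $$ (r mod dim_row B, c mod dim_col B))"

primrec tensor_upto :: "(nat \<Rightarrow> complex mat) \<Rightarrow> nat \<Rightarrow> complex mat" where
  "tensor_upto f 0 = 1\<^sub>m 1"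
| "tensor_upto f (Suc n) = kronecker (tensor_upto f n) (f (Suc n))"

definition pauli_Z :: "complex mat" where
  "pauli_Z = mat_of_rows_list 2 [[1, 0], [0, -1]]"

definition pauli_Z_string :: "nat \<Rightarrow> nat set \<Rightarrow> complex mat" where
  "pauli_Z_string n S = tensor_upto (\<lambda>m. if m \<in> S then pauli_Z else 1\<^sub>m 2) n"

text \<open>
  The exponential of a square matrix as the entrywise limit of its power series. The type of
  matrices with term-level dimension is not a Banach algebra, so the library's \<^term>\<open>exp\<close> does not
  apply to it. For the same reason the linear combination in \<open>hamiltonian\<close> is written entrywise.
\<close>

definition mat_exp :: "complex mat \<Rightarrow> complex mat" where
  "mat_exp A =
     mat (dim_row A) (dim_row A) (\<lambda>(r, c). \<Sum>k. (A ^\<^sub>m k) $$ (r, c) / of_nat (fact k))"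

definition hamiltonian :: "nat \<Rightarrow> nat \<Rightarrow> (nat \<Rightarrow> nat set) \<Rightarrow> (nat \<Rightarrow> real) \<Rightarrow> complex mat" where
  "hamiltonian n N Q \<theta> =
     mat (2 ^ n) (2 ^ n)
       (\<lambda>(r, c). \<Sum>j = 1..N. complex_of_real (\<theta> j) * pauli_Z_string n (Q j) $$ (r, c))"

definition pauli_Z_circuit :: "nat \<Rightarrow> nat \<Rightarrow> (nat \<Rightarrow> nat set) \<Rightarrow> (nat \<Rightarrow> real) \<Rightarrow> complex mat" where
  "pauli_Z_circuit n N Q \<theta> = mat_exp (\<i> \<cdot>\<^sub>m hamiltonian n N Q \<theta>)"

definition plus_state :: "nat \<Rightarrow> complex vec" where
  "plus_state n = vec (2 ^ n) (\<lambda>_. complex_of_real (2 powr (- real n / 2)))"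

text \<open>
  \<open>v \<bullet>c w\<close> conjugates its second argument, so \<open>(A *\<^sub>v \<psi>) \<bullet>c \<psi>\<close> is the expectation value
  of \<open>A\<close> in the state \<open>\<psi>\<close>.
\<close>

definition frame_potential ::
    "nat \<Rightarrow> complex vec \<Rightarrow> ((nat \<Rightarrow> real) \<Rightarrow> complex mat) \<Rightarrow> nat \<Rightarrow> real" where
  "frame_potential N \<psi> U t =
     1 / (2 * pi) ^ (2 * N) *
     (LINT p : ({1..N} \<rightarrow>\<^sub>E {-pi..pi}) \<times> ({1..N} \<rightarrow>\<^sub>E {-pi..pi})
        | (\<Pi>\<^sub>M j\<in>{1..N}. lborel) \<Otimes>\<^sub>M (\<Pi>\<^sub>M j\<in>{1..N}. lborel).
        norm (((mat_adjoint (U (fst p)) * U (snd p)) *\<^sub>v \<psi>) \<bullet>c \<psi>) ^ (2 * t))"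

text \<open>
  The product of the Pauli-Z strings of \<open>Q j\<close>, \<open>j \<in> J\<close>, is the Pauli-Z string of the iterated
  symmetric difference, i.e. of the set of qubits lying in an odd number of these \<open>Q j\<close>.
  The predicate below says that the generators of the circuit generate all Pauli-Z strings on
  \<open>n\<close> qubits. This is what makes \<open>n\<close> the minimum number of rotations (see the lemma):
  distinctness and non-emptiness of the \<open>Q j\<close> alone only give the upper bound. It is not
  redundant when \<open>N = n\<close>: for \<open>Q\<close> enumerating \<open>{1}\<close>, \<open>{2}\<close>, \<open>{1, 2}\<close> on three qubits the frame
  potential at \<open>t = 1\<close> is 1/4, whereas the Gamma quotient is 1/8.
\<close>

definition generates_Z_strings :: "nat \<Rightarrow> nat \<Rightarrow> (nat \<Rightarrow> nat set) \<Rightarrow> bool" where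
  "generates_Z_strings n N Q \<longleftrightarrow>
     (\<forall>S \<subseteq> {1..n}. \<exists>J \<subseteq> {1..N}. S = {m. odd (card {j \<in> J. m \<in> Q j})})"

lemma number_of_rotations_bounds:
  assumes "inj_on Q {1..N}"
    and "\<forall>j\<in>{1..N}. Q j \<noteq> {} \<and> Q j \<subseteq> {1..n}"
    and "generates_Z_strings n N Q"
  shows "n \<le> N \<and> N \<le> 2 ^ n - 1"
proof
  let ?f = "\<lambda>J. {m. odd (card {j \<in> J. m \<in> Q j})}"
  have "Pow {1..n} \<subseteq> ?f ` Pow {1..N}"
    using assms(3) unfolding generates_Z_strings_def by blast
  then have "card (Pow {1..n}) \<le> card (Pow {1..N})"
    by (meson finite_Pow_iff finite_atLeastAtMost finite_imageI card_mono card_image_le le_trans)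
  then show "n \<le> N" by (simp add: card_Pow)
  have "Q ` {1..N} \<subseteq> Pow {1..n} - {{}}" using assms(2) by auto
  then have "card (Q ` {1..N}) \<le> card (Pow {1..n} - {{}})" by (intro card_mono) auto
  then show "N \<le> 2 ^ n - 1" using assms(1) by (simp add: card_image card_Pow)
qed

end

theory Submission
  imports Defs
begin

text \<open>
  The circuit is diagonal, with entries \<open>exp (\<i> \<Sum>\<^sub>j \<theta>\<^sub>j s\<^sub>j(r))\<close> for signs \<open>s\<^sub>j(r) \<in> {1, -1}\<close>. When \<open>n\<close>
  generators produce all Pauli-Z strings, the \<open>2\<^sup>n\<close> basis vectors realise every sign pattern exactly
  once, so the overlap of two circuit states is \<open>\<Prod>\<^sub>j cos (\<theta>'\<^sub>j - \<theta>\<^sub>j)\<close>. The frame potential thus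
  factorises into \<open>n\<close> Wallis integrals of \<open>cos\<^bsup>2t\<^esup>\<close> over a full period.
\<close>

section \<open>Diagonal form of the Pauli-Z strings\<close>

lemma kronecker_mat_diag:
  "kronecker (mat_diag k f) (mat_diag l g) = mat_diag (k * l) (\<lambda>r. f (r div l) * g (r mod l))"
proof (rule eq_matI)
  fix i j assume "i < dim_row (mat_diag (k * l) (\<lambda>r. f (r div l) * g (r mod l)))"
    and "j < dim_col (mat_diag (k * l) (\<lambda>r. f (r div l) * g (r mod l)))"
  then have ij: "i < k * l" "j < k * l" by (simp_all add: mat_diag_def)
  then have l: "l > 0" by (cases l) auto
  have "i div l < k" "j div l < k" "i mod l < l" "j mod l < l"
    using ij l by (simp_all add: less_mult_imp_div_less)
  \<comment> \<open>Off the diagonal, the quotients or the remainders differ, so one of the two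
    Kronecker factors already vanishes.\<close>
  moreover have "i = j \<longleftrightarrow> i div l = j div l \<and> i mod l = j mod l"
    by (metis div_mod_decomp)
  ultimately show "kronecker (mat_diag k f) (mat_diag l g) $$ (i, j)
      = mat_diag (k * l) (\<lambda>r. f (r div l) * g (r mod l)) $$ (i, j)"
    using ij by (auto simp: kronecker_def mat_diag_def)
qed (simp_all add: kronecker_def mat_diag_def)

lemma pauli_Z_mat_diag: "pauli_Z = mat_diag 2 (\<lambda>r. (-1) ^ r)"
proof (rule eq_matI)
  fix i j assume "i < dim_row (mat_diag 2 (\<lambda>r. (-1) ^ r) :: complex mat)"
    "j < dim_col (mat_diag 2 (\<lambda>r. (-1) ^ r) :: complex mat)"
  then have "i = 0 \<or> i = 1" "j = 0 \<or> j = 1" by (auto simp: mat_diag_def)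
  then show "pauli_Z $$ (i, j) = mat_diag 2 (\<lambda>r. (-1) ^ r) $$ (i, j)"
    by (auto simp: pauli_Z_def mat_diag_def mat_of_rows_list_def)
qed (simp_all add: pauli_Z_def mat_diag_def mat_of_rows_list_def)

text \<open>The qubits that are in state 1 in the computational basis vector with index \<open>r\<close>.\<close>

primrec minus_qubits :: "nat \<Rightarrow> nat \<Rightarrow> nat set" where
  "minus_qubits 0 r = {}"
| "minus_qubits (Suc n) r = minus_qubits n (r div 2) \<union> (if odd r then {Suc n} else {})"

lemma minus_qubits_subset: "minus_qubits n r \<subseteq> {1..n}"
proof (induction n arbitrary: r)
  case (Suc n)
  from Suc[of "r div 2"] show ?case by auto
qed simp

lemma finite_minus_qubits: "finite (minus_qubits n r)"
  using minus_qubits_subset by (rule finite_subset) simp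

lemma Suc_notin_minus_qubits: "Suc n \<notin> minus_qubits n r"
  using minus_qubits_subset[of n r] by auto

text \<open>The lowest bit of the index is read off from membership of \<open>Suc n\<close>; the
  other bits form \<open>r div 2\<close>, to which the induction hypothesis applies.\<close>

lemma inj_on_minus_qubits: "inj_on (minus_qubits n) {..<2 ^ n}"
proof (induction n)
  case 0
  show ?case by (simp add: inj_on_def)
next
  case (Suc n)
  show ?case
  proof (rule inj_onI)
    fix r s :: nat
    assume rs: "r \<in> {..<2 ^ Suc n}" "s \<in> {..<2 ^ Suc n}"
      and eq: "minus_qubits (Suc n) r = minus_qubits (Suc n) s"
    have "odd k \<longleftrightarrow> Suc n \<in> minus_qubits (Suc n) k" for k
      using Suc_notin_minus_qubits by simp
    then have "odd r \<longleftrightarrow> odd s" using eq by blast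
    have "minus_qubits n (k div 2) = minus_qubits (Suc n) k - {Suc n}" for k
      using Suc_notin_minus_qubits[of n "k div 2"] by auto
    then have "minus_qubits n (r div 2) = minus_qubits n (s div 2)" using eq by blast
    moreover have "r div 2 \<in> {..<2 ^ n}" "s div 2 \<in> {..<2 ^ n}"
      using rs by (simp_all add: less_mult_imp_div_less mult.commute)
    ultimately have "r div 2 = s div 2"
      by (rule inj_onD[OF Suc.IH])
    moreover have "r mod 2 = s mod 2"
      using \<open>odd r \<longleftrightarrow> odd s\<close> by (simp add: parity_cases mod2_eq_if)
    ultimately show "r = s" by (metis div_mod_decomp)
  qed
qed

text \<open>Each Z that acts on a qubit in state 1 contributes a factor -1. The induction fits
  because the last Kronecker factor governs the lowest bit of the index, which
  \<open>minus_qubits\<close> assigns to the last qubit.\<close>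

lemma pauli_Z_string_mat_diag:
  "pauli_Z_string n S = mat_diag (2 ^ n) (\<lambda>r. (-1) ^ card (S \<inter> minus_qubits n r))"
proof (induction n)
  case 0
  show ?case by (simp add: pauli_Z_string_def)
next
  case (Suc n)
  have factor: "(if Suc n \<in> S then pauli_Z else 1\<^sub>m 2)
      = mat_diag 2 (\<lambda>r. if Suc n \<in> S then (-1) ^ r else 1)"
    by (simp add: pauli_Z_mat_diag)
  have sign: "(-1) ^ card (S \<inter> minus_qubits n (r div 2)) * (if Suc n \<in> S then (-1) ^ (r mod 2) else 1)
      = ((-1) ^ card (S \<inter> minus_qubits (Suc n) r) :: complex)" for r
    by (cases "odd r")
       (simp_all add: Int_insert_right finite_minus_qubits Suc_notin_minus_qubits odd_iff_mod_2_eq_one)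
  have "pauli_Z_string (Suc n) S = kronecker (pauli_Z_string n S) (if Suc n \<in> S then pauli_Z else 1\<^sub>m 2)"
    by (simp add: pauli_Z_string_def)
  also have "\<dots> = mat_diag (2 ^ Suc n) (\<lambda>r. (-1) ^ card (S \<inter> minus_qubits n (r div 2)) *
      (if Suc n \<in> S then (-1) ^ (r mod 2) else 1))"
    unfolding Suc.IH factor kronecker_mat_diag by (simp add: mult.commute)
  finally show ?case unfolding sign .
qed

lemma pow_mat_diag: "mat_diag d f ^\<^sub>m k = mat_diag d (\<lambda>r. f r ^ k)"
proof (induction k)
  case 0
  show ?case by simp (simp add: mat_diag_def)
next
  case (Suc k)
  then show ?case by (simp flip: power_Suc2)
qed

lemma mat_exp_mat_diag: "mat_exp (mat_diag d f) = mat_diag d (\<lambda>r. exp (f r))"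
proof (rule eq_matI)
  fix i j assume "i < dim_row (mat_diag d (\<lambda>r. exp (f r)))" "j < dim_col (mat_diag d (\<lambda>r. exp (f r)))"
  then have ij: "i < d" "j < d" by (simp_all add: mat_diag_def)
  then have "mat_exp (mat_diag d f) $$ (i, j) = (\<Sum>k. mat_diag d (\<lambda>r. f r ^ k) $$ (i, j) / fact k)"
    by (simp add: mat_exp_def pow_mat_diag) (simp add: mat_diag_def)
  also have "\<dots> = mat_diag d (\<lambda>r. exp (f r)) $$ (i, j)"
    using ij by (simp add: mat_diag_def exp_def scaleR_conv_of_real divide_inverse mult.commute)
  finally show "mat_exp (mat_diag d f) $$ (i, j) = mat_diag d (\<lambda>r. exp (f r)) $$ (i, j)" .
qed (simp_all add: mat_exp_def mat_diag_def)

section \<open>The circuit as a diagonal matrix and its expectation value\<close>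

text \<open>The eigenvalue of the Hamiltonian on the basis vector with index
  \<open>r\<close>.\<close>

definition phase :: "nat \<Rightarrow> nat \<Rightarrow> (nat \<Rightarrow> nat set) \<Rightarrow> (nat \<Rightarrow> real) \<Rightarrow> nat \<Rightarrow> real" where
  "phase n N Q \<theta> r = (\<Sum>j = 1..N. \<theta> j * (-1) ^ card (Q j \<inter> minus_qubits n r))"

lemma phase_diff: "phase n N Q \<theta>' r - phase n N Q \<theta> r = phase n N Q (\<lambda>j. \<theta>' j - \<theta> j) r"
  by (simp add: phase_def left_diff_distrib flip: sum_subtractf)

lemma pauli_Z_circuit_mat_diag:
  "pauli_Z_circuit n N Q \<theta> = mat_diag (2 ^ n) (\<lambda>r. cis (phase n N Q \<theta> r))"
proof -
  have "\<i> \<cdot>\<^sub>m hamiltonian n N Q \<theta> = mat_diag (2 ^ n) (\<lambda>r. \<i> * complex_of_real (phase n N Q \<theta> r))"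
    by (rule eq_matI)
       (auto simp: hamiltonian_def pauli_Z_string_mat_diag mat_diag_def phase_def)
  then show ?thesis
    by (simp add: pauli_Z_circuit_def mat_exp_mat_diag cis_conv_exp)
qed

lemma adjoint_mat_diag: "mat_adjoint (mat_diag d f) = mat_diag d (\<lambda>r. cnj (f r))"
  by (rule eq_matI) (auto simp: mat_adjoint_def mat_of_rows_def mat_diag_def)

lemma mat_diag_mult_vec: "mat_diag d f *\<^sub>v vec d g = vec d (\<lambda>r. f r * g r)"
proof (rule eq_vecI)
  fix i assume "i < dim_vec (vec d (\<lambda>r. f r * g r))"
  then have i: "i < d" by simp
  then have "(mat_diag d f *\<^sub>v vec d g) $ i = (\<Sum>j = 0..<d. (if i = j then f j else 0) * g j)"
    by (simp add: mat_diag_def scalar_prod_def)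
  also have "\<dots> = (\<Sum>j = 0..<d. if i = j then f j * g j else 0)"
    by (intro sum.cong) auto
  finally have "(mat_diag d f *\<^sub>v vec d g) $ i = (\<Sum>j = 0..<d. if i = j then f j * g j else 0)" .
  then show "(mat_diag d f *\<^sub>v vec d g) $ i = vec d (\<lambda>r. f r * g r) $ i"
    using i by simp
qed (simp add: mat_diag_def)

text \<open>All amplitudes of the plus state are equal with square \<open>1 / 2 ^ n\<close>, so a
  diagonal expectation value is the plain average of the diagonal.\<close>

lemma expectation_mat_diag_plus_state:
  "(mat_diag (2 ^ n) f *\<^sub>v plus_state n) \<bullet>c plus_state n = (\<Sum>r<2 ^ n. f r) / 2 ^ n"
proof -
  have "2 powr (- real n / 2) * 2 powr (- real n / 2) = 2 powr (- real n)"
    unfolding powr_add[symmetric] by simp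
  also have "\<dots> = 1 / 2 ^ n"
    unfolding powr_minus_divide by (simp add: powr_realpow)
  finally have "complex_of_real (2 powr (- real n / 2)) * complex_of_real (2 powr (- real n / 2)) = 1 / 2 ^ n"
    by (metis of_real_1 of_real_divide of_real_mult of_real_numeral of_real_power)
  then show ?thesis
    unfolding plus_state_def mat_diag_mult_vec
    by (simp add: scalar_prod_def mult.assoc sum_divide_distrib atLeast0LessThan)
qed

section \<open>Sign patterns of the generators and the overlap of circuit states\<close>

text \<open>Double counting of the pairs \<open>(j, m)\<close> with \<open>m\<close> in
  \<open>Q j\<close> and \<open>B\<close>; modulo 2 only those \<open>m\<close> survive that lie in
  an odd number of the \<open>Q j\<close>. In terms of signs: a product of strings is the string of
  the symmetric difference.\<close>

lemma even_sum_card_Int: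
  assumes "finite J" "finite B"
  shows "even (\<Sum>j\<in>J. card (Q j \<inter> B)) \<longleftrightarrow> even (card ({m. odd (card {j \<in> J. m \<in> Q j})} \<inter> B))"
proof -
  have "(\<Sum>j\<in>J. card (Q j \<inter> B)) = (\<Sum>j\<in>J. \<Sum>m\<in>B. if m \<in> Q j then 1 else 0)"
    using assms by (intro sum.cong refl) (simp add: Int_commute flip: sum.inter_filter Int_def)
  also have "\<dots> = (\<Sum>m\<in>B. \<Sum>j\<in>J. if m \<in> Q j then 1 else 0)"
    by (rule sum.swap)
  also have "\<dots> = (\<Sum>m\<in>B. card {j \<in> J. m \<in> Q j})"
    using assms by (intro sum.cong refl) (simp flip: sum.inter_filter)
  finally have "even (\<Sum>j\<in>J. card (Q j \<inter> B)) \<longleftrightarrow> even (card {m \<in> B. odd (card {j \<in> J. m \<in> Q j})})"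
    using assms by (simp add: even_sum_iff)
  also have "{m \<in> B. odd (card {j \<in> J. m \<in> Q j})} = {m. odd (card {j \<in> J. m \<in> Q j})} \<inter> B"
    by auto
  finally show ?thesis .
qed

text \<open>The sign pattern of a basis vector: the rotations whose generator has eigenvalue -1 on
  it.\<close>

definition minus_rotations :: "nat \<Rightarrow> nat \<Rightarrow> (nat \<Rightarrow> nat set) \<Rightarrow> nat \<Rightarrow> nat set" where
  "minus_rotations n N Q r = {j \<in> {1..N}. odd (card (Q j \<inter> minus_qubits n r))}"

text \<open>Since the generators produce every single-qubit \<open>Z\<close>, their signs on a basis vector determine
  each of its bits.\<close>

lemma inj_on_minus_rotations:
  assumes "generates_Z_strings n N Q"
  shows "inj_on (minus_rotations n N Q) {..<2 ^ n}"
proof (rule inj_onI)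
  fix r s assume rs: "r \<in> {..<2 ^ n}" "s \<in> {..<2 ^ n}"
    and eq: "minus_rotations n N Q r = minus_rotations n N Q s"
  have "m \<in> minus_qubits n r \<longleftrightarrow> m \<in> minus_qubits n s" if m: "m \<in> {1..n}" for m
  proof -
    have "{m} \<subseteq> {1..n}" using m by simp
    from assms[unfolded generates_Z_strings_def, rule_format, OF this]
    obtain J where J: "J \<subseteq> {1..N}" "{m} = {m. odd (card {j \<in> J. m \<in> Q j})}"
      by (elim exE conjE) (rule that)
    have fin: "finite J" using J(1) by (rule finite_subset) simp
    \<comment> \<open>The generators in \<open>J\<close> multiply to the single Z on qubit
      \<open>m\<close>, so bit \<open>m\<close> is the parity of the number of negative signs among
      them.\<close>
    have bit: "m \<in> minus_qubits n r \<longleftrightarrow> odd (card {j \<in> J. j \<in> minus_rotations n N Q r})" for r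
    proof -
      have "m \<in> minus_qubits n r \<longleftrightarrow> odd (card ({m} \<inter> minus_qubits n r))"
        by (cases "m \<in> minus_qubits n r") simp_all
      also have "\<dots> \<longleftrightarrow> odd (\<Sum>j\<in>J. card (Q j \<inter> minus_qubits n r))"
        by (simp only: even_sum_card_Int[OF fin finite_minus_qubits] J(2)[symmetric])
      also have "\<dots> \<longleftrightarrow> odd (card {j \<in> J. odd (card (Q j \<inter> minus_qubits n r))})"
        using fin by (simp add: even_sum_iff)
      also have "{j \<in> J. odd (card (Q j \<inter> minus_qubits n r))} = {j \<in> J. j \<in> minus_rotations n N Q r}"
        using J(1) by (auto simp: minus_rotations_def)
      finally show ?thesis .
    qed
    show ?thesis unfolding bit eq ..
  qed
  then have "minus_qubits n r = minus_qubits n s"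
    using minus_qubits_subset by blast
  then show "r = s" using rs by (rule inj_onD[OF inj_on_minus_qubits])
qed

text \<open>With as many rotations as qubits, there are \<open>2 ^ n\<close> basis vectors and
  equally many sign patterns, so injectivity already forces surjectivity.\<close>

lemma bij_betw_minus_rotations:
  assumes "generates_Z_strings n n Q"
  shows "bij_betw (minus_rotations n n Q) {..<2 ^ n} (Pow {1..n})"
proof -
  have "card (minus_rotations n n Q ` {..<2 ^ n}) = card (Pow {1..n})"
    using inj_on_minus_rotations[OF assms] by (simp add: card_image card_Pow)
  then have "minus_rotations n n Q ` {..<2 ^ n} = Pow {1..n}"
    by (intro card_subset_eq) (auto simp: minus_rotations_def)
  then show ?thesis
    using inj_on_minus_rotations[OF assms] by (simp add: bij_betw_def)
qed

text \<open>Sorting the factors by sign into a set and its complement gives the shape of one term in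
  the expansion of a product of binomials.\<close>

lemma cis_phase:
  "cis (phase n N Q x r) =
     (\<Prod>j\<in>minus_rotations n N Q r. cis (- x j)) * (\<Prod>j\<in>{1..N} - minus_rotations n N Q r. cis (x j))"
proof -
  have "cis (phase n N Q x r) = (\<Prod>j = 1..N. cis (x j * (-1) ^ card (Q j \<inter> minus_qubits n r)))"
    by (simp add: phase_def cis_conv_exp exp_sum sum_distrib_left)
  also have "\<dots> = (\<Prod>j = 1..N. if j \<in> minus_rotations n N Q r then cis (- x j) else cis (x j))"
    by (intro prod.cong refl) (auto simp: minus_rotations_def)
  also have "\<dots> = (\<Prod>j\<in>{1..N} \<inter> minus_rotations n N Q r. cis (- x j)) *
      (\<Prod>j\<in>{1..N} - minus_rotations n N Q r. cis (x j))"
    by (simp add: prod.If_cases Diff_eq)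
  also have "{1..N} \<inter> minus_rotations n N Q r = minus_rotations n N Q r"
    by (auto simp: minus_rotations_def)
  finally show ?thesis .
qed

lemma sum_cis_phase:
  assumes "generates_Z_strings n n Q"
  shows "(\<Sum>r<2 ^ n. cis (phase n n Q x r)) = 2 ^ n * (\<Prod>j = 1..n. complex_of_real (cos (x j)))"
proof -
  have "(\<Sum>r<2 ^ n. cis (phase n n Q x r)) =
      (\<Sum>J\<in>Pow {1..n}. (\<Prod>j\<in>J. cis (- x j)) * (\<Prod>j\<in>{1..n} - J. cis (x j)))"
    unfolding cis_phase by (rule sum.reindex_bij_betw[OF bij_betw_minus_rotations[OF assms]])
  \<comment> \<open>Since every subset of \<open>{1..n}\<close> occurs exactly once, the sum is the
    full expansion of this product.\<close>
  also have "\<dots> = (\<Prod>j = 1..n. cis (- x j) + cis (x j))"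
    by (simp add: prod_add)
  also have "\<dots> = (\<Prod>j = 1..n. 2 * complex_of_real (cos (x j)))"
    by (intro prod.cong refl) (simp add: complex_eq_iff)
  finally show ?thesis by (simp add: prod.distrib)
qed

lemma norm_circuit_overlap:
  assumes "generates_Z_strings n n Q"
  shows "norm (((mat_adjoint (pauli_Z_circuit n n Q \<theta>) * pauli_Z_circuit n n Q \<theta>') *\<^sub>v plus_state n)
      \<bullet>c plus_state n) ^ (2 * t) = (\<Prod>j = 1..n. cos (\<theta>' j - \<theta> j) ^ (2 * t))"
proof -
  have "cnj (cis (phase n n Q \<theta> r)) * cis (phase n n Q \<theta>' r) = cis (phase n n Q (\<lambda>j. \<theta>' j - \<theta> j) r)" for r
    by (simp add: cis_cnj cis_mult phase_diff)
  then have "((mat_adjoint (pauli_Z_circuit n n Q \<theta>) * pauli_Z_circuit n n Q \<theta>') *\<^sub>v plus_state n)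
      \<bullet>c plus_state n = complex_of_real (\<Prod>j = 1..n. cos (\<theta>' j - \<theta> j))"
    by (simp add: pauli_Z_circuit_mat_diag adjoint_mat_diag expectation_mat_diag_plus_state
        sum_cis_phase[OF assms])
  \<comment> \<open>The overlap is real, and the even exponent absorbs the absolute value.\<close>
  then show ?thesis
    by (simp add: power_mult prod_power_distrib flip: of_real_prod)
qed

section \<open>The Wallis integral\<close>

text \<open>Integrating the derivative of \<open>cos\<^bsup>2t+1\<^esup> sin\<close> over a full period gives the recursion in \<open>t\<close>;
  this works for every shift \<open>a\<close>, so no substitution is needed.\<close>

lemma has_bochner_integral_cos_power:
  "has_bochner_integral lborel (\<lambda>y. indicator {-pi..pi} y * cos (y - a) ^ (2 * t))
     (2 * pi * (Gamma (real t + 1 / 2) / (sqrt pi * Gamma (real t + 1))))"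
proof (induction t)
  case 0
  show ?case
    by (simp add: Gamma_one_half_real has_bochner_integral_iff)
next
  case (Suc t)
  define F where "F y = cos (y - a) ^ (2 * t + 1) * sin (y - a)" for y
  \<comment> \<open>The derivative of \<open>F\<close>, with the squared sine replaced by 1 minus
    the squared cosine so that only even powers of the cosine remain.\<close>
  define f where "f y = (2 * real t + 2) * cos (y - a) ^ (2 * Suc t) - (2 * real t + 1) * cos (y - a) ^ (2 * t)" for y
  define W where "W = 2 * pi * (Gamma (real t + 1 / 2) / (sqrt pi * Gamma (real t + 1)))"
  have deriv: "(F has_real_derivative f y) (at y)" for y
  proof -
    have "((\<lambda>y. cos (y - a)) has_real_derivative - sin (y - a)) (at y)"
      "((\<lambda>y. sin (y - a)) has_real_derivative cos (y - a)) (at y)"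
      by (auto intro!: derivative_eq_intros)
    from DERIV_mult[OF DERIV_power[OF this(1), of "2 * t + 1"] this(2)]
    have "(F has_real_derivative (real (2 * t + 1) * cos (y - a) ^ (2 * t) * (- sin (y - a)) * sin (y - a)
        + cos (y - a) ^ (2 * t + 1) * cos (y - a))) (at y)"
      unfolding F_def [abs_def] by (rule DERIV_cong) (simp add: mult_ac)
    also have "real (2 * t + 1) * cos (y - a) ^ (2 * t) * (- sin (y - a)) * sin (y - a)
        + cos (y - a) ^ (2 * t + 1) * cos (y - a) =
        - (2 * real t + 1) * cos (y - a) ^ (2 * t) * (sin (y - a))\<^sup>2 + cos (y - a) ^ (2 * t) * (cos (y - a))\<^sup>2"
      by (simp add: power2_eq_square algebra_simps)
    also have "\<dots> = f y"
      unfolding sin_squared_eq f_def by (simp add: power2_eq_square algebra_simps)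
    finally show ?thesis .
  qed
  have "has_bochner_integral lborel (\<lambda>y. indicator {-pi..pi} y *\<^sub>R f y) (F pi - F (- pi))"
  proof (rule has_bochner_integral_FTC_Icc)
    show "(F has_vector_derivative f y) (at y within {-pi..pi})" for y
      using deriv by (simp add: has_real_derivative_iff_has_vector_derivative has_vector_derivative_at_within)
  qed (auto simp: f_def intro!: continuous_intros)
  \<comment> \<open>The endpoints are a full period of \<open>F\<close> apart, for every shift
    \<open>a\<close>.\<close>
  moreover have "F pi - F (- pi) = 0"
    by (simp add: F_def sin_diff cos_diff)
  ultimately have "has_bochner_integral lborel (\<lambda>y. indicator {-pi..pi} y * f y) 0"
    by simp
  \<comment> \<open>Adding \<open>2 * real t + 1\<close> times the induction hypothesis cancels the
    lower power in \<open>f\<close>.\<close>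
  from has_bochner_integral_add[OF this has_bochner_integral_mult_right[OF Suc.IH[folded W_def], of "2 * real t + 1"]]
  have "has_bochner_integral lborel (\<lambda>y. (2 * real t + 2) * (indicator {-pi..pi} y * cos (y - a) ^ (2 * Suc t)))
      ((2 * real t + 1) * W)"
    by (simp add: f_def algebra_simps)
  from has_bochner_integral_mult_right[OF this, of "1 / (2 * real t + 2)"]
  have *: "has_bochner_integral lborel (\<lambda>y. indicator {-pi..pi} y * cos (y - a) ^ (2 * Suc t))
      ((2 * real t + 1) / (2 * real t + 2) * W)"
    by (simp add: add_nonneg_eq_0_iff)
  \<comment> \<open>By the functional equation, numerator and denominator of the Gamma quotient grow
    by \<open>real t + 1 / 2\<close> and \<open>real t + 1\<close>; their ratio is the factor of the
    recursion.\<close>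
  have "Gamma (real (Suc t) + 1 / 2) = (real t + 1 / 2) * Gamma (real t + 1 / 2)"
    using Gamma_plus1[of "real t + 1 / 2"] nonpos_Ints_nonpos[of "real t + 1 / 2"] by (force simp: add_ac)
  moreover have "Gamma (real (Suc t) + 1) = (real t + 1) * Gamma (real t + 1)"
    using Gamma_fact[of t, where ?'a = real] Gamma_fact[of "Suc t", where ?'a = real] by (simp add: add_ac)
  moreover have "(2 * real t + 1) / (2 * real t + 2) = (real t + 1 / 2) / (real t + 1)"
    by (simp add: field_simps)
  ultimately have "(2 * real t + 1) / (2 * real t + 2) * W =
      2 * pi * (Gamma (real (Suc t) + 1 / 2) / (sqrt pi * Gamma (real (Suc t) + 1)))"
    by (simp only: W_def) (simp add: mult_ac)
  then show ?case using * by simp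
qed

section \<open>Integration over pairs of points of a cube\<close>

text \<open>For an extensional \<open>x\<close>, membership in the cube is a condition on each
  coordinate separately. This lets the cube indicator be distributed over the factors of a product
  integrand.\<close>

lemma indicator_PiE_eq_prod:
  assumes "finite I" "x \<in> extensional I"
  shows "indicator (I \<rightarrow>\<^sub>E A) x = (\<Prod>i\<in>I. indicator A (x i) :: 'a :: comm_semiring_1)"
proof (cases "x \<in> I \<rightarrow>\<^sub>E A")
  case True
  then show ?thesis by (auto intro!: prod.neutral[symmetric] simp: PiE_iff)
next
  case False
  then obtain i where "i \<in> I" "x i \<notin> A" using assms by (auto simp: PiE_iff)
  then have "(\<Prod>i\<in>I. indicator A (x i) :: 'a) = 0"
    using assms by (intro prod_zero) (auto intro: bexI[of _ i])
  then show ?thesis using False by simp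
qed

text \<open>If the inner integrals do not depend on the shift, the outer integral only contributes the
  volume of the cube.\<close>

lemma integral_prod_shift:
  fixes f :: "real \<Rightarrow> real" and I :: "'i set"
  assumes I: "finite I"
    and [measurable]: "f \<in> borel_measurable borel"
    and bound: "\<And>y. \<bar>f y\<bar> \<le> 1"
    and ab: "a \<le> b"
    and inner: "\<And>s. has_bochner_integral lborel (\<lambda>y. indicator {a..b} y * f (y - s)) c"
  shows "(LINT p : (I \<rightarrow>\<^sub>E {a..b}) \<times> (I \<rightarrow>\<^sub>E {a..b}) | (\<Pi>\<^sub>M j\<in>I. lborel) \<Otimes>\<^sub>M (\<Pi>\<^sub>M j\<in>I. lborel).
      \<Prod>j\<in>I. f (snd p j - fst p j)) = ((b - a) * c) ^ card I"
proof -
  let ?M = "\<Pi>\<^sub>M j\<in>I. (lborel :: real measure)" and ?C = "I \<rightarrow>\<^sub>E {a..b}"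
  interpret product_sigma_finite "\<lambda>_ :: 'i. lborel :: real measure" ..
  interpret M: sigma_finite_measure ?M by (rule sigma_finite[OF I])
  interpret P: pair_sigma_finite ?M ?M ..
  have C [measurable]: "?C \<in> sets ?M" using I by (intro sets_PiM_I_finite) auto
  have vol: "emeasure ?M ?C = ennreal ((b - a) ^ card I)"
    using I ab by (simp add: emeasure_PiM ennreal_power)
  have CC: "emeasure (?M \<Otimes>\<^sub>M ?M) (?C \<times> ?C) < \<infinity>"
    using M.emeasure_pair_measure_Times[OF C C] vol by (simp add: ennreal_mult_less_top)
  \<comment> \<open>Integrability, needed for Fubini, holds because the integrand is bounded by 1 on
    a set of finite measure.\<close>
  have integ: "integrable (?M \<Otimes>\<^sub>M ?M) (\<lambda>p. indicator (?C \<times> ?C) p *\<^sub>R (\<Prod>j\<in>I. f (snd p j - fst p j)))"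
  proof (rule integrableI_bounded_set_indicator[where B = 1])
    show "AE p in ?M \<Otimes>\<^sub>M ?M. p \<in> ?C \<times> ?C \<longrightarrow> norm (\<Prod>j\<in>I. f (snd p j - fst p j)) \<le> 1"
      using bound by (auto simp: abs_prod intro!: prod_le_1)
  qed (use CC in measurable)
  \<comment> \<open>For fixed \<open>x\<close> the integrand is a product of functions of single
    coordinates of \<open>y\<close>, so its integral factorises; each factor equals \<open>c\<close>
    whatever the shift \<open>x j\<close>.\<close>
  have inner': "(\<integral>y. indicator (?C \<times> ?C) (x, y) *\<^sub>R (\<Prod>j\<in>I. f (y j - x j)) \<partial>?M) = indicator ?C x * c ^ card I" for x
  proof -
    have "(\<integral>y. indicator (?C \<times> ?C) (x, y) *\<^sub>R (\<Prod>j\<in>I. f (y j - x j)) \<partial>?M) =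
        (\<integral>y. indicator ?C x * (\<Prod>j\<in>I. indicator {a..b} (y j) * f (y j - x j)) \<partial>?M)"
    proof (rule Bochner_Integration.integral_cong)
      fix y assume "y \<in> space ?M"
      then have "y \<in> extensional I" by (simp add: space_PiM PiE_def)
      then have "indicator ?C y = (\<Prod>j\<in>I. indicator {a..b} (y j) :: real)"
        by (rule indicator_PiE_eq_prod[OF I])
      then show "indicator (?C \<times> ?C) (x, y) *\<^sub>R (\<Prod>j\<in>I. f (y j - x j)) =
          indicator ?C x * (\<Prod>j\<in>I. indicator {a..b} (y j) * f (y j - x j))"
        by (simp add: indicator_times prod.distrib)
    qed simp
    also have "\<dots> = indicator ?C x * (\<Prod>j\<in>I. \<integral>y. indicator {a..b} y * f (y - x j) \<partial>lborel)"
      using inner by (subst Bochner_Integration.integral_mult_right_zero, subst product_integral_prod[OF I])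
        (auto simp: has_bochner_integral_iff)
    also have "\<dots> = indicator ?C x * c ^ card I"
      using inner by (simp add: has_bochner_integral_iff)
    finally show ?thesis .
  qed
  have "(LINT p : ?C \<times> ?C | ?M \<Otimes>\<^sub>M ?M. \<Prod>j\<in>I. f (snd p j - fst p j)) = (\<integral>x. indicator ?C x * c ^ card I \<partial>?M)"
    unfolding set_lebesgue_integral_def P.integral_fst'[OF integ, symmetric] fst_conv snd_conv inner' ..
  also have "\<dots> = (b - a) ^ card I * c ^ card I"
    using ab C by (simp add: measure_def vol)
  finally show ?thesis by (simp add: power_mult_distrib)
qed

theorem theorem6:
  fixes n N t :: nat and Q :: "nat \<Rightarrow> nat set"
  assumes "n \<ge> 1"
    and "\<forall>j\<in>{1..N}. Q j \<noteq> {} \<and> Q j \<subseteq> {1..n}"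
    and "inj_on Q {1..N}"
    and "generates_Z_strings n N Q"
    and "N = n"
    and "t > 0"
  shows "frame_potential N (plus_state n) (pauli_Z_circuit n N Q) t
       = (Gamma (real t + 1 / 2) / (sqrt pi * Gamma (real t + 1))) ^ n"
proof -
  have gen: "generates_Z_strings n n Q" using assms by simp
  define G where "G = Gamma (real t + 1 / 2) / (sqrt pi * Gamma (real t + 1))"
  have "frame_potential n (plus_state n) (pauli_Z_circuit n n Q) t =
      1 / (2 * pi) ^ (2 * n) * ((pi - - pi) * (2 * pi * G)) ^ card {1..n}"
    unfolding frame_potential_def norm_circuit_overlap[OF gen] G_def
    by (subst integral_prod_shift[where f = "\<lambda>y. cos y ^ (2 * t)"])
       (use has_bochner_integral_cos_power in \<open>auto simp: power_abs power_le_one\<close>)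
  \<comment> \<open>Each coordinate contributes \<open>(2 * pi) ^ 2 * G\<close>, and the
    normalisation cancels exactly the powers of \<open>2 * pi\<close>.\<close>
  also have "\<dots> = G ^ n"
    by (simp add: power_mult power_mult_distrib power2_eq_square)
  finally show ?thesis using assms(5) by (simp add: G_def)
qed

end
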